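(* Let $1\leq p<\infty$ and let $g\in \mathrm{BMOA}$ be non-constant. Then $[T_g,H^p]$, equipped with the norm $\|f\|_{[T_g,H^p]}=\|T_g(f)\|_{p}$, is a Banach space.
   Context: $\mathbb D$ is the open unit disk and $\mathrm{Hol}(\mathbb D)$ is the space of analytic functions on $\mathbb D$. For $1\le p<\infty$, $H^p$ is the Hardy space of $f\in\mathrm{Hol}(\mathbb D)$ with $\|f\|_p=\sup_{0\le r<1}\left(\int_0^{2\pi}|f(re^{it})|^p\frac{dt}{2\pi}\right)^{1/p}<\infty$. $\mathrm{BMOA}$ is the space of $g\in H^2$ with $\sup_{a\in\mathbb D}\|g\circ\phi_a-g(a)\|_2<\infty$, where $\phi_a(z)=\frac{a-z}{1-\overline a z}$. For $f,g\in\mathrm{Hol}(\mathbb D)$, the generalized Volterra operator is $T_g(f)(z)=\int_0^z f(\zeta)g'(\zeta)\,d\zeta$, $z\in\mathbb D$. The optimal domain is $[T_g,H^p]=\{f\in\mathrm{Hol}(\mathbb D): T_g(f)\in H^p\}$. *)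

theory Defs
  imports "HOL-Complex_Analysis.Complex_Analysis" "HOL-Library.Function_Algebras"
begin

abbreviation unit_disc :: "complex set" where
  "unit_disc \<equiv> ball 0 1"

text \<open>
  An analytic function on the disc is represented by its extension by \<open>0\<close>, so that
  equality on the disc is equality in HOL and the pointwise operations of
  \<^theory>\<open>HOL-Library.Function_Algebras\<close> make the set below a vector space of functions.
\<close>

definition Hol_disc :: "(complex \<Rightarrow> complex) set" where
  "Hol_disc = {f. f holomorphic_on unit_disc \<and> (\<forall>z. z \<notin> unit_disc \<longrightarrow> f z = 0)}"

text \<open>
  The supremum is taken in the extended nonnegative reals, so it is \<open>\<infinity>\<close> exactly when
  the integral means are unbounded. Only values of \<open>f\<close> inside the disc are used.
\<close>

definition Hardy_enorm :: "real \<Rightarrow> (complex \<Rightarrow> complex) \<Rightarrow> ennreal" where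
  "Hardy_enorm p f =
     (SUP r\<in>{0..<1::real}.
        ennreal ((integral {0..2*pi} (\<lambda>t. cmod (f (of_real r * cis t)) powr p) / (2*pi)) powr (1/p)))"

definition Hardy_space :: "real \<Rightarrow> (complex \<Rightarrow> complex) set" where
  "Hardy_space p = {f \<in> Hol_disc. Hardy_enorm p f < \<infinity>}"

definition Hardy_norm :: "real \<Rightarrow> (complex \<Rightarrow> complex) \<Rightarrow> real" where
  "Hardy_norm p f = enn2real (Hardy_enorm p f)"

definition disc_involution :: "complex \<Rightarrow> complex \<Rightarrow> complex" where
  "disc_involution a z = (a - z) / (1 - cnj a * z)"

definition BMOA :: "(complex \<Rightarrow> complex) set" where
  "BMOA = {g \<in> Hardy_space 2.
     (SUP a\<in>unit_disc. Hardy_enorm 2 (\<lambda>z. g (disc_involution a z) - g a)) < \<infinity>}"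

definition Volterra :: "(complex \<Rightarrow> complex) \<Rightarrow> (complex \<Rightarrow> complex) \<Rightarrow> (complex \<Rightarrow> complex)" where
  "Volterra g f =
     (\<lambda>z. if z \<in> unit_disc
          then contour_integral (linepath 0 z) (\<lambda>\<zeta>. f \<zeta> * deriv g \<zeta>) else 0)"

definition optimal_domain :: "(complex \<Rightarrow> complex) \<Rightarrow> real \<Rightarrow> (complex \<Rightarrow> complex) set" where
  "optimal_domain g p = {f \<in> Hol_disc. Volterra g f \<in> Hardy_space p}"

definition optimal_norm :: "(complex \<Rightarrow> complex) \<Rightarrow> real \<Rightarrow> (complex \<Rightarrow> complex) \<Rightarrow> real" where
  "optimal_norm g p f = Hardy_norm p (Volterra g f)"

text \<open>
  \<open>V\<close> is a linear subspace of a complex vector space, \<open>N\<close> restricts to a norm on \<open>V\<close>,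
  and \<open>V\<close> is complete for \<open>N\<close>. Nothing is required of \<open>N\<close> outside \<open>V\<close>.
\<close>

definition complex_Banach_space_on ::
  "(complex \<Rightarrow> 'v \<Rightarrow> 'v) \<Rightarrow> 'v::ab_group_add set \<Rightarrow> ('v \<Rightarrow> real) \<Rightarrow> bool" where
  "complex_Banach_space_on smul V N \<longleftrightarrow>
     vector_space smul \<and> module.subspace smul V \<and>
     (\<forall>x\<in>V. 0 \<le> N x) \<and>
     (\<forall>x\<in>V. N x = 0 \<longleftrightarrow> x = 0) \<and>
     (\<forall>c. \<forall>x\<in>V. N (smul c x) = cmod c * N x) \<and>
     (\<forall>x\<in>V. \<forall>y\<in>V. N (x + y) \<le> N x + N y) \<and>
     (\<forall>s :: nat \<Rightarrow> 'v. range s \<subseteq> V \<and>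
        (\<forall>e>0. \<exists>M. \<forall>m\<ge>M. \<forall>n\<ge>M. N (s m - s n) < e) \<longrightarrow>
        (\<exists>x\<in>V. (\<lambda>n. N (s n - x)) \<longlonglongrightarrow> 0))"

end

(* The integral means of T_g f control T_g f and, by Cauchy's estimates, (T_g f)' = f g' locally
   uniformly. The zeros of g' are isolated, so every compact subset of the disc lies inside a circle
   on which |g'| is bounded below; there f is controlled by f g', and inside it by the maximum
   principle. Hence point evaluations are bounded on [T_g, H^p], locally uniformly: the norm is
   definite, and a Cauchy sequence converges locally uniformly to some x in Hol(D). The passage to
   the limit in the norm uses Minkowski's inequality on each circle instead of Fatou's lemma:
   T_g (s m - x) is uniformly small on the circle for large m. *)
theory Submission
  imports Defs
begin

section \<open>Minkowski's inequality for integrals over an interval\<close>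

text \<open>Convexity of the \<open>p\<close>-th power, with \<open>(x + y) / (a + b)\<close> read
  as the convex combination of \<open>x / a\<close> and \<open>y / b\<close> with weights
  \<open>a / (a + b)\<close> and \<open>b / (a + b)\<close>. With \<open>a\<close> and
  \<open>b\<close> in the role of norm bounds, integration turns it into Minkowski's
  inequality.\<close>

lemma powr_add_le_weighted:
  fixes x y a b p :: real
  assumes "1 \<le> p" "0 \<le> x" "0 \<le> y" "0 < a" "0 < b"
  shows "(x + y) powr p \<le>
    (a + b) powr p * (a / (a + b) * (x powr p / a powr p) + b / (a + b) * (y powr p / b powr p))"
proof -
  \<comment> \<open>The case of a vanishing summand, settled by monotonicity of the power
    \<open>p - 1\<close>; convexity is invoked only for positive \<open>x\<close> and
    \<open>y\<close>.\<close>
  have one: "u powr p \<le> (c + d) powr p * (c / (c + d) * (u powr p / c powr p))"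
    if "0 \<le> u" "0 < c" "0 < d" for u c d :: real
  proof -
    have "c powr (p - 1) \<le> (c + d) powr (p - 1)"
      using that assms(1) by (intro powr_mono2) auto
    then have "u powr p * 1 \<le> u powr p * ((c + d) powr (p - 1) / c powr (p - 1))"
      using that by (intro mult_left_mono) auto
    also have "\<dots> = (c + d) powr p * (c / (c + d) * (u powr p / c powr p))"
      using that by (simp add: powr_diff)
    finally show ?thesis by simp
  qed
  consider "x = 0" | "y = 0" | "0 < x" "0 < y"
    using assms by linarith
  then show ?thesis
  proof cases
    case 1
    then show ?thesis using one[of y b a] assms by (simp add: add.commute)
  next
    case 2
    then show ?thesis using one[of x a b] assms by simp
  next
    case 3
    have w: "1 - b / (a + b) = a / (a + b)"
      using assms by (simp add: field_simps)
    have "((1 - b / (a + b)) *\<^sub>R (x / a) + (b / (a + b)) *\<^sub>R (y / b)) powr p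
      \<le> (1 - b / (a + b)) * (x / a) powr p + b / (a + b) * (y / b) powr p"
      by (rule convex_onD[OF powr_convex[OF assms(1)]]) (use 3 assms in auto)
    moreover have "(1 - b / (a + b)) *\<^sub>R (x / a) + (b / (a + b)) *\<^sub>R (y / b) = (x + y) / (a + b)"
      unfolding w using assms by (simp add: add_divide_distrib)
    ultimately have "((x + y) / (a + b)) powr p
      \<le> a / (a + b) * (x powr p / a powr p) + b / (a + b) * (y powr p / b powr p)"
      unfolding w using 3 assms by (simp add: powr_divide)
    then have "(a + b) powr p * ((x + y) / (a + b)) powr p \<le> (a + b) powr p *
       (a / (a + b) * (x powr p / a powr p) + b / (a + b) * (y powr p / b powr p))"
      by (rule mult_left_mono) simp
    then show ?thesis
      using 3 assms by (simp add: powr_divide)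
  qed
qed

text \<open>Integrating the weighted inequality works because its two weights add up to 1. Positive
  bounds \<open>a\<close> and \<open>b\<close> replace the norms themselves, so that no denominator
  vanishes and no root is taken; \<open>L\<close> stands for the normalising factor, later the
  length \<open>2 * pi\<close> of the parameter interval.\<close>

lemma Minkowski_integral_bound:
  fixes u v :: "real \<Rightarrow> complex"
  assumes "1 \<le> p" "0 < a" "0 < b"
    and u: "continuous_on {s..t} u" and v: "continuous_on {s..t} v"
    and Iu: "integral {s..t} (\<lambda>x. cmod (u x) powr p) \<le> L * a powr p"
    and Iv: "integral {s..t} (\<lambda>x. cmod (v x) powr p) \<le> L * b powr p"
  shows "integral {s..t} (\<lambda>x. cmod (u x + v x) powr p) \<le> L * (a + b) powr p"
proof -
  have int: "(\<lambda>x. cmod (w x) powr p) integrable_on {s..t}" if "continuous_on {s..t} w" for w :: "real \<Rightarrow> complex"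
    using assms(1) that
    by (intro integrable_continuous_real continuous_on_powr' continuous_intros) auto
  \<comment> \<open>Chosen so that \<open>k * a powr p\<close> and \<open>l * b powr p\<close> are
    the shares \<open>a / (a + b)\<close> and \<open>b / (a + b)\<close> of
    \<open>(a + b) powr p\<close>.\<close>
  define k where "k = (a + b) powr p * (a / (a + b)) / a powr p"
  define l where "l = (a + b) powr p * (b / (a + b)) / b powr p"
  have nonneg: "0 \<le> k" "0 \<le> l"
    using assms unfolding k_def l_def by auto
  have "integral {s..t} (\<lambda>x. cmod (u x + v x) powr p)
      \<le> integral {s..t} (\<lambda>x. k * cmod (u x) powr p + l * cmod (v x) powr p)"
  proof (rule integral_le)
    show "(\<lambda>x. cmod (u x + v x) powr p) integrable_on {s..t}"
      by (intro int continuous_on_add u v)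
    show "(\<lambda>x. k * cmod (u x) powr p + l * cmod (v x) powr p) integrable_on {s..t}"
      using int[OF u] int[OF v] by (intro integrable_add integrable_on_mult_right)
    show "cmod (u x + v x) powr p \<le> k * cmod (u x) powr p + l * cmod (v x) powr p" for x
    proof -
      have "cmod (u x + v x) powr p \<le> (cmod (u x) + cmod (v x)) powr p"
        using assms(1) by (intro powr_mono2 norm_triangle_ineq) auto
      also have "\<dots> \<le> k * cmod (u x) powr p + l * cmod (v x) powr p"
        using powr_add_le_weighted[of p "cmod (u x)" "cmod (v x)" a b] assms
        unfolding k_def l_def by (simp add: distrib_left mult.assoc)
      finally show ?thesis .
    qed
  qed
  also have "\<dots> = k * integral {s..t} (\<lambda>x. cmod (u x) powr p) + l * integral {s..t} (\<lambda>x. cmod (v x) powr p)"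
    using int[OF u] int[OF v] by (subst integral_add) (auto intro: integrable_on_mult_right)
  also have "\<dots> \<le> k * (L * a powr p) + l * (L * b powr p)"
    using Iu Iv nonneg by (intro add_mono mult_left_mono)
  also have "\<dots> = L * (k * a powr p + l * b powr p)"
    by (simp add: algebra_simps)
  also have "k * a powr p + l * b powr p = (a + b) powr p * (a / (a + b) + b / (a + b))"
    using assms unfolding k_def l_def by (simp add: distrib_left)
  also have "a / (a + b) + b / (a + b) = 1"
    using assms by (simp add: add_divide_distrib[symmetric])
  finally show ?thesis by simp
qed

section \<open>Integral means and the norm of the Hardy space\<close>

lemma continuous_on_circle:
  assumes "f holomorphic_on unit_disc" "r \<in> {0..<1}"
  shows "continuous_on S (\<lambda>t. f (of_real r * cis t))"
  by (rule continuous_on_compose2[OF holomorphic_on_imp_continuous_on[OF assms(1)]])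
     (use assms(2) in \<open>auto intro!: continuous_intros simp: norm_mult\<close>)

lemma integrable_on_circle:
  assumes "f holomorphic_on unit_disc" "r \<in> {0..<1}" "1 \<le> p"
  shows "(\<lambda>t. cmod (f (of_real r * cis t)) powr p) integrable_on {a..b}"
  using assms(3) by (intro integrable_continuous_real continuous_on_powr' continuous_intros
    continuous_on_circle[OF assms(1,2)]) auto

text \<open>Removes the supremum, the root and the extended reals at once: a norm bound becomes a
  family of integral inequalities, one for each circle.\<close>

lemma Hardy_enorm_le_iff:
  assumes "f holomorphic_on unit_disc" "1 \<le> p" "0 \<le> C"
  shows "Hardy_enorm p f \<le> ennreal C \<longleftrightarrow>
    (\<forall>r\<in>{0..<1}. integral {0..2*pi} (\<lambda>t. cmod (f (of_real r * cis t)) powr p) \<le> 2 * pi * C powr p)"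
proof -
  have "(integral {0..2*pi} (\<lambda>t. cmod (f (of_real r * cis t)) powr p) / (2*pi)) powr (1/p) \<le> C \<longleftrightarrow>
    integral {0..2*pi} (\<lambda>t. cmod (f (of_real r * cis t)) powr p) \<le> 2 * pi * C powr p"
    if "r \<in> {0..<1}" for r
  proof -
    define I where "I = integral {0..2*pi} (\<lambda>t. cmod (f (of_real r * cis t)) powr p)"
    have "0 \<le> I"
      unfolding I_def by (intro integral_nonneg integrable_on_circle assms that) auto
    \<comment> \<open>Strict monotonicity of the \<open>p\<close>-th power gives the converse
      implication by contraposition.\<close>
    have "(I / (2*pi)) powr (1/p) \<le> C \<longleftrightarrow> ((I / (2*pi)) powr (1/p)) powr p \<le> C powr p"
      using powr_mono2[of p "(I / (2*pi)) powr (1/p)" C] powr_less_mono2[of p C "(I / (2*pi)) powr (1/p)"] assms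
      by force
    also have "((I / (2*pi)) powr (1/p)) powr p = I / (2*pi)"
      using assms \<open>0 \<le> I\<close> by (simp add: powr_powr)
    finally show ?thesis
      unfolding I_def by (simp add: field_simps)
  qed
  then show ?thesis
    unfolding Hardy_enorm_def using assms(3) by (simp add: SUP_le_iff)
qed

lemma Hardy_norm_nonneg: "0 \<le> Hardy_norm p f"
  by (simp add: Hardy_norm_def)

lemma Hardy_spaceI:
  assumes "f \<in> Hol_disc" "Hardy_enorm p f \<le> ennreal C" "0 \<le> C"
  shows "f \<in> Hardy_space p" "Hardy_norm p f \<le> C"
  using assms unfolding Hardy_space_def Hardy_norm_def
  by (auto simp: enn2real_leI le_less_trans)

lemma Hardy_enorm_eq_norm:
  assumes "f \<in> Hardy_space p"
  shows "Hardy_enorm p f = ennreal (Hardy_norm p f)"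
  using assms unfolding Hardy_space_def Hardy_norm_def by simp

lemma Hol_disc_add: "f \<in> Hol_disc \<Longrightarrow> h \<in> Hol_disc \<Longrightarrow> f + h \<in> Hol_disc"
  unfolding Hol_disc_def plus_fun_def by (auto intro: holomorphic_intros)

lemma Hol_disc_cmult: "f \<in> Hol_disc \<Longrightarrow> (\<lambda>z. c * f z) \<in> Hol_disc"
  unfolding Hol_disc_def by (auto intro: holomorphic_intros)

lemma Hardy_norm_triangle:
  assumes "1 \<le> p" "f \<in> Hardy_space p" "h \<in> Hardy_space p"
  shows "f + h \<in> Hardy_space p" "Hardy_norm p (f + h) \<le> Hardy_norm p f + Hardy_norm p h"
proof -
  have hol: "f \<in> Hol_disc" "h \<in> Hol_disc" "f holomorphic_on unit_disc" "h holomorphic_on unit_disc"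
    using assms by (auto simp: Hardy_space_def Hol_disc_def)
  have le: "Hardy_enorm p (f + h) \<le> ennreal (Hardy_norm p f + Hardy_norm p h + e)" if "0 < e" for e
  proof -
    \<comment> \<open>The slack \<open>e / 2\<close> keeps both bounds positive even when a norm is
      0, as \<open>Minkowski_integral_bound\<close> demands.\<close>
    define a where "a = Hardy_norm p f + e / 2"
    define b where "b = Hardy_norm p h + e / 2"
    have ab: "0 < a" "0 < b" and le: "Hardy_enorm p f \<le> ennreal a" "Hardy_enorm p h \<le> ennreal b"
      using that Hardy_norm_nonneg[of p f] Hardy_norm_nonneg[of p h] assms
      by (auto simp: a_def b_def Hardy_enorm_eq_norm intro!: ennreal_leI)
    have "integral {0..2*pi} (\<lambda>t. cmod (f (of_real r * cis t) + h (of_real r * cis t)) powr p)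
       \<le> 2 * pi * (a + b) powr p" if "r \<in> {0..<1}" for r
      using le ab assms(1) hol that
      by (intro Minkowski_integral_bound continuous_on_circle) (auto simp: Hardy_enorm_le_iff)
    then have "Hardy_enorm p (f + h) \<le> ennreal (a + b)"
      using ab assms(1) hol by (subst Hardy_enorm_le_iff) (auto simp: plus_fun_def intro: holomorphic_intros)
    then show ?thesis by (simp add: a_def b_def add_ac)
  qed
  show "f + h \<in> Hardy_space p"
    using Hardy_spaceI(1)[OF Hol_disc_add[OF hol(1,2)] le[of 1]]
      Hardy_norm_nonneg[of p f] Hardy_norm_nonneg[of p h] by simp
  show "Hardy_norm p (f + h) \<le> Hardy_norm p f + Hardy_norm p h"
  proof (rule field_le_epsilon)
    fix e :: real assume "0 < e"
    then show "Hardy_norm p (f + h) \<le> Hardy_norm p f + Hardy_norm p h + e"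
      using Hardy_spaceI(2)[OF Hol_disc_add[OF hol(1,2)] le]
        Hardy_norm_nonneg[of p f] Hardy_norm_nonneg[of p h] by simp
  qed
qed

lemma Hardy_norm_cmult_le:
  assumes "1 \<le> p" "f \<in> Hardy_space p"
  shows "(\<lambda>z. c * f z) \<in> Hardy_space p" "Hardy_norm p (\<lambda>z. c * f z) \<le> cmod c * Hardy_norm p f"
proof -
  have hol: "f \<in> Hol_disc" "f holomorphic_on unit_disc"
    using assms by (auto simp: Hardy_space_def Hol_disc_def)
  have le: "Hardy_enorm p f \<le> ennreal (Hardy_norm p f)"
    using assms by (simp add: Hardy_enorm_eq_norm)
  have "integral {0..2*pi} (\<lambda>t. cmod (c * f (of_real r * cis t)) powr p)
      \<le> 2 * pi * (cmod c * Hardy_norm p f) powr p" if r: "r \<in> {0..<1}" for r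
  proof -
    have "integral {0..2*pi} (\<lambda>t. cmod (c * f (of_real r * cis t)) powr p)
      = cmod c powr p * integral {0..2*pi} (\<lambda>t. cmod (f (of_real r * cis t)) powr p)"
      by (simp add: norm_mult powr_mult)
    also have "\<dots> \<le> cmod c powr p * (2 * pi * Hardy_norm p f powr p)"
      using le hol assms r by (intro mult_left_mono) (auto simp: Hardy_enorm_le_iff Hardy_norm_nonneg)
    finally show ?thesis
      by (simp add: powr_mult Hardy_norm_nonneg mult_ac)
  qed
  then have "Hardy_enorm p (\<lambda>z. c * f z) \<le> ennreal (cmod c * Hardy_norm p f)"
    using hol assms(1) by (subst Hardy_enorm_le_iff) (auto simp: Hardy_norm_nonneg intro: holomorphic_intros)
  from Hardy_spaceI[OF Hol_disc_cmult[OF hol(1)] this]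
  show "(\<lambda>z. c * f z) \<in> Hardy_space p" "Hardy_norm p (\<lambda>z. c * f z) \<le> cmod c * Hardy_norm p f"
    by (auto simp: Hardy_norm_nonneg)
qed

text \<open>The inequality for \<open>c\<close> and \<open>f\<close>, applied again to
  \<open>inverse c\<close> and the function \<open>c * f\<close>, yields its own reverse.\<close>

lemma Hardy_norm_cmult:
  assumes "1 \<le> p" "f \<in> Hardy_space p"
  shows "Hardy_norm p (\<lambda>z. c * f z) = cmod c * Hardy_norm p f"
proof (cases "c = 0")
  case True
  then show ?thesis
    using Hardy_norm_cmult_le(2)[OF assms, of c] Hardy_norm_nonneg[of p "\<lambda>z. c * f z"] by auto
next
  case False
  have "Hardy_norm p f \<le> cmod (inverse c) * Hardy_norm p (\<lambda>z. c * f z)"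
    using Hardy_norm_cmult_le(2)[OF assms(1) Hardy_norm_cmult_le(1)[OF assms, of c], of "inverse c"] False
    by (simp add: mult.assoc[symmetric])
  then have "cmod c * Hardy_norm p f \<le> Hardy_norm p (\<lambda>z. c * f z)"
    using False by (simp add: norm_divide field_simps)
  then show ?thesis
    using Hardy_norm_cmult_le(2)[OF assms, of c] by simp
qed

section \<open>Point evaluations on Hardy spaces\<close>

text \<open>Cauchy's integral formula on the circle of radius \<open>R\<close>, where the distance
  to \<open>z\<close> is at least \<open>R - cmod z\<close>.\<close>

lemma Cauchy_estimate_circle_mean:
  assumes "f holomorphic_on unit_disc" "R \<in> {0..<1}" "cmod z < R"
    and L1: "integral {0..2*pi} (\<lambda>t. cmod (f (of_real R * cis t))) \<le> 2 * pi * A"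
  shows "cmod (f z) \<le> R * A / (R - cmod z)"
proof -
  let ?F = "\<lambda>t. f (of_real R * cis t) / (of_real R * cis t - z) * of_real R * \<i> * cis t"
  have "((\<lambda>u. f u / (u - z)) has_contour_integral (2 * of_real pi * \<i> * f z)) (circlepath 0 R)"
    by (rule Cauchy_integral_circlepath_simple)
       (use assms in \<open>auto intro: holomorphic_on_subset\<close>)
  \<comment> \<open>The contour integral over the parameter \<open>t\<close>; the factor
    \<open>R * \<i> * cis t\<close> is the derivative of the parametrisation.\<close>
  then have F: "(?F has_integral (2 * of_real pi * \<i> * f z)) {0..2*pi}"
    unfolding circlepath_def by (subst (asm) has_contour_integral_part_circlepath_iff) auto
  have cont: "(\<lambda>t. cmod (f (of_real R * cis t))) integrable_on {0..2*pi}"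
    by (intro integrable_continuous_real continuous_intros continuous_on_circle assms)
  have "cmod (integral {0..2*pi} ?F) \<le>
      integral {0..2*pi} (\<lambda>t. R / (R - cmod z) * cmod (f (of_real R * cis t)))"
  proof (rule integral_norm_bound_integral)
    show "?F integrable_on {0..2*pi}" using F by blast
    show "(\<lambda>t. R / (R - cmod z) * cmod (f (of_real R * cis t))) integrable_on {0..2*pi}"
      using cont by (rule integrable_on_mult_right)
    show "cmod (?F t) \<le> R / (R - cmod z) * cmod (f (of_real R * cis t))" for t
    proof -
      have "R - cmod z \<le> cmod (of_real R * cis t - z)"
        using norm_triangle_ineq2[of "of_real R * cis t" z] assms by (simp add: norm_mult)
      then have "cmod (f (of_real R * cis t)) * R / cmod (of_real R * cis t - z)
         \<le> cmod (f (of_real R * cis t)) * R / (R - cmod z)"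
        using assms by (intro divide_left_mono mult_nonneg_nonneg mult_pos_pos) auto
      then show ?thesis
        using assms by (simp add: norm_mult norm_divide mult_ac)
    qed
  qed
  also have "\<dots> = R / (R - cmod z) * integral {0..2*pi} (\<lambda>t. cmod (f (of_real R * cis t)))"
    by simp
  also have "\<dots> \<le> R / (R - cmod z) * (2 * pi * A)"
    using assms by (intro mult_left_mono) auto
  finally have "2 * pi * cmod (f z) \<le> 2 * pi * (R * A / (R - cmod z))"
    using integral_unique[OF F] by (simp add: norm_mult mult_ac)
  then show ?thesis by (rule mult_left_le_imp_le) simp
qed

text \<open>The circle estimate is used at the radius half way between \<open>cmod z\<close> and 1.
  The constant 4 is a factor 2 from this choice times a factor 2 from bounding the mean of the
  modulus by the \<open>p\<close>-th mean.\<close>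

lemma Hardy_point_bound:
  assumes "1 \<le> p" "F \<in> Hardy_space p" "cmod z < 1"
  shows "cmod (F z) \<le> 4 / (1 - cmod z) * Hardy_norm p F"
proof (rule dense_ge)
  have hol: "F holomorphic_on unit_disc"
    using assms by (auto simp: Hardy_space_def Hol_disc_def)
  define R where "R = (1 + cmod z) / 2"
  have R: "R \<in> {0..<1}" "cmod z < R" "R - cmod z = (1 - cmod z) / 2" "0 \<le> R"
    using assms(3) by (auto simp: R_def field_simps)
  \<comment> \<open>Working with an arbitrary strictly larger \<open>B\<close> makes
    \<open>A\<close> positive, so that dividing by \<open>A powr p\<close> is safe even for norm 0.
    \<open>A\<close> is scaled so that the final estimate comes out as exactly
    \<open>B\<close>.\<close>
  fix B assume B: "4 / (1 - cmod z) * Hardy_norm p F < B"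
  define A where "A = B * (1 - cmod z) / 4"
  have "Hardy_norm p F < A"
    using B assms(3) by (simp add: A_def field_simps)
  then have A: "0 < A" "Hardy_enorm p F \<le> ennreal A"
    using Hardy_norm_nonneg[of p F] assms by (auto simp: Hardy_enorm_eq_norm intro!: ennreal_leI)
  define k where "k = A / A powr p"
  have Ip: "integral {0..2*pi} (\<lambda>t. cmod (F (of_real R * cis t)) powr p) \<le> 2 * pi * A powr p"
    using A R hol assms by (simp add: Hardy_enorm_le_iff)
  have int: "(\<lambda>t. cmod (F (of_real R * cis t)) powr p) integrable_on {0..2*pi}"
    by (intro integrable_on_circle hol R assms)
  have "0 \<le> k" using A by (simp add: k_def)
  \<comment> \<open>Jensen is replaced by \<open>x \<le> 1 + x powr p\<close> at the normalised value, at the cost of a factor 2.\<close>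
  have pt: "x \<le> A + k * x powr p" if "0 \<le> x" for x
  proof (cases "x \<le> A")
    case True
    then show ?thesis using \<open>0 \<le> k\<close> by (simp add: add_increasing2)
  next
    case False
    then have "(x / A) powr 1 \<le> (x / A) powr p"
      using A assms(1) by (intro powr_mono) auto
    then show ?thesis
      using A that False by (simp add: k_def powr_divide field_simps add_increasing)
  qed
  have "integral {0..2*pi} (\<lambda>t. cmod (F (of_real R * cis t)))
     \<le> integral {0..2*pi} (\<lambda>t. A + k * cmod (F (of_real R * cis t)) powr p)"
  proof (rule integral_le)
    show "(\<lambda>t. cmod (F (of_real R * cis t))) integrable_on {0..2*pi}"
      by (intro integrable_continuous_real continuous_on_norm continuous_on_circle hol R)
    show "(\<lambda>t. A + k * cmod (F (of_real R * cis t)) powr p) integrable_on {0..2*pi}"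
      by (intro integrable_add[OF integrable_const_ivl] integrable_on_mult_right[OF int])
  qed (rule pt, simp)
  also have "\<dots> = 2 * pi * A + k * integral {0..2*pi} (\<lambda>t. cmod (F (of_real R * cis t)) powr p)"
    by (subst integral_add[OF integrable_const_ivl integrable_on_mult_right[OF int]]) simp
  also have "\<dots> \<le> 2 * pi * A + k * (2 * pi * A powr p)"
    by (intro add_left_mono mult_left_mono Ip \<open>0 \<le> k\<close>)
  also have "\<dots> = 2 * pi * (2 * A)" using A by (simp add: k_def)
  finally have "cmod (F z) \<le> R * (2 * A) / (R - cmod z)"
    by (intro Cauchy_estimate_circle_mean hol R) 
  also have "\<dots> \<le> 1 * (2 * A) / (R - cmod z)"
    using A R by (intro divide_right_mono mult_right_mono) auto
  also have "\<dots> = B"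
    unfolding R(3) A_def using assms(3) by (simp add: field_simps)
  finally show "cmod (F z) \<le> B" .
qed

section \<open>Circles free of zeros\<close>

text \<open>A compact disc contains only finitely many zeros of \<open>h\<close>, so they exclude
  finitely many of the infinitely many radii in an interval; on a circle that remains, the modulus
  attains a positive minimum.\<close>

lemma holomorphic_nonzero_on_circle:
  assumes h: "h holomorphic_on unit_disc" and w: "w \<in> unit_disc" "h w \<noteq> 0" and r: "r < 1"
  obtains \<rho> \<delta> where "r < \<rho>" "0 < \<rho>" "\<rho> < 1" "0 < \<delta>" "\<And>z. cmod z = \<rho> \<Longrightarrow> \<delta> \<le> cmod (h z)"
proof -
  \<comment> \<open>\<open>r\<close> may be negative; the truncation keeps the new radius
    positive.\<close>
  define s where "s = max r 0"
  define K where "K = cball (0::complex) ((1 + s) / 2)"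
  have s: "0 \<le> s" "r \<le> s" "s < 1" "s < (1 + s) / 2" using r by (auto simp: s_def)
  have "finite {z\<in>K. h z = 0}"
  \<comment> \<open>A constant \<open>h\<close> equals its nonzero value at \<open>w\<close>;
    otherwise the identity theorem applies in the form of finiteness of zeros on compact
    sets.\<close>
  proof (cases "h constant_on unit_disc")
    case True
    then have "h z \<noteq> 0" if "z \<in> K" for z
      using that w s unfolding K_def constant_on_def by force
    then show ?thesis by (simp cong: conj_cong)
  next
    case False
    then show ?thesis
      using s unfolding K_def by (intro holomorphic_compact_finite_zeros[OF h]) auto
  qed
  moreover have "infinite {s<..<(1 + s) / 2}"
    using s by (simp add: infinite_Ioo)
  ultimately obtain \<rho> where \<rho>: "\<rho> \<in> {s<..<(1 + s) / 2}" "\<rho> \<notin> cmod ` {z\<in>K. h z = 0}"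
    by (meson finite_imageI finite_subset subsetI)
  then have \<rho>': "r < \<rho>" "0 < \<rho>" "\<rho> < 1" using s by auto
  have "continuous_on (sphere 0 \<rho>) (\<lambda>z. cmod (h z))"
    using \<rho>' by (intro continuous_on_norm continuous_on_subset[OF holomorphic_on_imp_continuous_on[OF h]]) auto
  then obtain z0 where z0: "z0 \<in> sphere 0 \<rho>" "\<And>z. z \<in> sphere 0 \<rho> \<Longrightarrow> cmod (h z0) \<le> cmod (h z)"
    using continuous_attains_inf[of "sphere 0 \<rho>" "\<lambda>z. cmod (h z)"] \<rho>' by auto
  show thesis
  proof (rule that[OF \<rho>', of "cmod (h z0)"])
    show "0 < cmod (h z0)" using z0(1) \<rho> by (force simp: K_def)
  qed (use z0 in auto)
qed

section \<open>The Volterra operator\<close>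

lemma holomorphic_mult_deriv:
  assumes "g holomorphic_on unit_disc" "f \<in> Hol_disc"
  shows "(\<lambda>\<zeta>. f \<zeta> * deriv g \<zeta>) holomorphic_on unit_disc"
  using assms by (auto simp: Hol_disc_def intro!: holomorphic_intros)

text \<open>On the convex disc the integrand has a primitive \<open>G\<close>, and integration along
  the segment from 0 to \<open>w\<close> gives \<open>G w - G 0\<close>.\<close>

lemma Volterra_has_field_derivative:
  assumes "g holomorphic_on unit_disc" "f \<in> Hol_disc" "z \<in> unit_disc"
  shows "(Volterra g f has_field_derivative f z * deriv g z) (at z)"
proof -
  obtain G where G: "\<And>x. x \<in> unit_disc \<Longrightarrow> (G has_field_derivative f x * deriv g x) (at x within unit_disc)"
    using holomorphic_convex_primitive'[OF convex_ball open_ball holomorphic_mult_deriv[OF assms(1,2)]] by blast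
  have eq: "G w - G 0 = Volterra g f w" if "w \<in> unit_disc" for w
  proof -
    have "closed_segment 0 w \<subseteq> unit_disc"
      using that by (intro closed_segment_subset) auto
    then have "((\<lambda>\<zeta>. f \<zeta> * deriv g \<zeta>) has_contour_integral (G w - G 0)) (linepath 0 w)"
      using contour_integral_primitive[of unit_disc G "\<lambda>\<zeta>. f \<zeta> * deriv g \<zeta>" "linepath 0 w"] G by simp
    then show ?thesis
      using that by (simp add: Volterra_def contour_integral_unique)
  qed
  have "((\<lambda>w. G w - G 0) has_field_derivative f z * deriv g z) (at z)"
    using G[OF assms(3)] at_within_open[OF assms(3) open_ball] by (auto intro!: derivative_eq_intros)
  then show ?thesis
    by (rule has_field_derivative_transform_within_open[OF _ open_ball assms(3) eq])
qed

lemma Volterra_in_Hol_disc: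
  assumes "g holomorphic_on unit_disc" "f \<in> Hol_disc"
  shows "Volterra g f \<in> Hol_disc"
proof -
  have "Volterra g f holomorphic_on unit_disc"
    using Volterra_has_field_derivative[OF assms] holomorphic_on_open[OF open_ball] by blast
  then show ?thesis by (simp add: Hol_disc_def Volterra_def)
qed

lemma Volterra_integrable:
  assumes "g holomorphic_on unit_disc" "f \<in> Hol_disc" "z \<in> unit_disc"
  shows "(\<lambda>\<zeta>. f \<zeta> * deriv g \<zeta>) contour_integrable_on linepath 0 z"
proof (rule contour_integrable_continuous_linepath)
  have "closed_segment 0 z \<subseteq> unit_disc"
    using assms(3) by (intro closed_segment_subset) auto
  then show "continuous_on (closed_segment 0 z) (\<lambda>\<zeta>. f \<zeta> * deriv g \<zeta>)"
    using holomorphic_mult_deriv[OF assms(1,2)] holomorphic_on_imp_continuous_on continuous_on_subset by blast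
qed

lemma Volterra_add:
  assumes "g holomorphic_on unit_disc" "f \<in> Hol_disc" "h \<in> Hol_disc"
  shows "Volterra g (f + h) = Volterra g f + Volterra g h"
  by (rule ext) (auto simp: Volterra_def distrib_right contour_integral_add Volterra_integrable assms)

lemma Volterra_cmult:
  assumes "g holomorphic_on unit_disc" "f \<in> Hol_disc"
  shows "Volterra g (\<lambda>z. c * f z) = (\<lambda>z. c * Volterra g f z)"
proof
  fix z
  show "Volterra g (\<lambda>z. c * f z) z = c * Volterra g f z"
    using contour_integral_lmul[OF Volterra_integrable[OF assms, of z], of c]
    by (simp add: Volterra_def mult.assoc)
qed

text \<open>Continuity of the operator for uniform convergence on a closed disc:
  \<open>deriv g\<close> is bounded there and segments from 0 stay inside. \<open>K\<close> is fixed
  before \<open>f\<close>, \<open>B\<close> and \<open>z\<close>, so one constant serves a whole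
  sequence.\<close>

lemma Volterra_bound:
  assumes g: "g holomorphic_on unit_disc" and r: "0 \<le> r" "r < 1"
  obtains K where "0 < K"
    "\<And>f B z. f \<in> Hol_disc \<Longrightarrow> (\<And>u. cmod u \<le> r \<Longrightarrow> cmod (f u) \<le> B) \<Longrightarrow> cmod z \<le> r \<Longrightarrow>
      cmod (Volterra g f z) \<le> K * B"
proof -
  have "continuous_on (cball 0 r) (deriv g)"
    using r by (intro continuous_on_subset[OF holomorphic_on_imp_continuous_on[OF
      holomorphic_deriv[OF g open_ball]]]) auto
  then have "compact (deriv g ` cball 0 r)"
    by (rule compact_continuous_image) simp
  then obtain K where K: "0 < K" "\<And>u. cmod u \<le> r \<Longrightarrow> cmod (deriv g u) \<le> K"
    by (auto dest!: compact_imp_bounded simp: bounded_pos)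
  show thesis
  proof (rule that[OF K(1)])
    fix f B z assume f: "f \<in> Hol_disc" and B: "\<And>u. cmod u \<le> r \<Longrightarrow> cmod (f u) \<le> B" and z: "cmod z \<le> r"
    have "0 \<le> B" using B[of 0] r(1) norm_ge_zero[of "f 0"] by (simp del: norm_ge_zero)
    have seg: "closed_segment 0 z \<subseteq> cball 0 r"
      using z r by (intro closed_segment_subset) auto
    have "cmod (contour_integral (linepath 0 z) (\<lambda>\<zeta>. f \<zeta> * deriv g \<zeta>)) \<le> (B * K) * cmod (z - 0)"
    proof (rule contour_integral_bound_linepath)
      show "(\<lambda>\<zeta>. f \<zeta> * deriv g \<zeta>) contour_integrable_on linepath 0 z"
        using z r by (intro Volterra_integrable g f) auto
      fix u assume "u \<in> closed_segment 0 z"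
      with seg have "cmod u \<le> r" by auto
      then show "cmod (f u * deriv g u) \<le> B * K"
        using B K \<open>0 \<le> B\<close> by (simp add: norm_mult mult_mono)
    qed (use K \<open>0 \<le> B\<close> in auto)
    also have "\<dots> \<le> (B * K) * 1"
      using z r K \<open>0 \<le> B\<close> by (intro mult_left_mono) auto
    finally show "cmod (Volterra g f z) \<le> K * B"
      using z r by (simp add: Volterra_def mult.commute)
  qed
qed

section \<open>Point evaluations on the optimal domain\<close>

lemma optimal_point_bound:
  assumes p: "1 \<le> p" and g: "g holomorphic_on unit_disc" and nc: "\<not> g constant_on unit_disc" and r: "r < 1"
  obtains C where "0 < C"
    "\<And>f z. f \<in> optimal_domain g p \<Longrightarrow> cmod z \<le> r \<Longrightarrow> cmod (f z) \<le> C * optimal_norm g p f"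
proof -
  \<comment> \<open>If \<open>deriv g\<close> vanished throughout the convex disc, \<open>g\<close>
    would be constant.\<close>
  have "\<exists>w\<in>unit_disc. deriv g w \<noteq> 0"
  proof (rule ccontr)
    assume "\<not> ?thesis"
    then have "(g has_field_derivative 0) (at x within unit_disc)" if "x \<in> unit_disc" for x
      using that holomorphic_derivI[OF g open_ball, of x] has_field_derivative_at_within by metis
    then have "\<exists>c. \<forall>x\<in>unit_disc. g x = c"
      by (intro has_field_derivative_zero_constant) auto
    with nc show False unfolding constant_on_def by blast
  qed
  then obtain w where w: "w \<in> unit_disc" "deriv g w \<noteq> 0" by blast
  have g': "deriv g holomorphic_on unit_disc" using g by (intro holomorphic_intros) auto
  obtain \<rho> \<delta> where \<rho>: "r < \<rho>" "0 < \<rho>" "\<rho> < 1" and \<delta>: "0 < \<delta>" "\<And>z. cmod z = \<rho> \<Longrightarrow> \<delta> \<le> cmod (deriv g z)"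
    using holomorphic_nonzero_on_circle[OF g' w r] by metis
  \<comment> \<open>Discs of radius \<open>d\<close> about points of the circle stay within radius
    \<open>\<rho> + d\<close>, which is again at distance \<open>d\<close> from the unit
    circle.\<close>
  define d where "d = (1 - \<rho>) / 2"
  have d: "0 < d" "\<rho> + d < 1" "1 - (\<rho> + d) = d" using \<rho> by (auto simp: d_def field_simps)
  \<comment> \<open>The factors come from the point bound for \<open>F\<close> up to radius
    \<open>\<rho> + d\<close>, from Cauchy's inequality for its derivative on discs of radius
    \<open>d\<close>, and from division by \<open>deriv g\<close>.\<close>
  define C where "C = 4 / d / d / \<delta>"
  show thesis
  proof (rule that[of C])
    show "0 < C" using d \<delta> by (simp add: C_def)
    fix f z assume f: "f \<in> optimal_domain g p" and z: "cmod z \<le> r"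
    define F where "F = Volterra g f"
    have fH: "f \<in> Hol_disc" "F \<in> Hardy_space p" and N: "optimal_norm g p f = Hardy_norm p F"
      using f by (auto simp: optimal_domain_def optimal_norm_def F_def)
    have holF: "F holomorphic_on unit_disc" and holf: "f holomorphic_on unit_disc"
      using fH by (auto simp: Hol_disc_def Hardy_space_def)
    have Fle: "cmod (F u) \<le> 4 / d * Hardy_norm p F" if "cmod u \<le> \<rho> + d" for u
    proof -
      have "cmod (F u) \<le> 4 / (1 - cmod u) * Hardy_norm p F"
        using that d by (intro Hardy_point_bound p fH) auto
      also have "\<dots> \<le> 4 / d * Hardy_norm p F"
        using that d by (intro mult_right_mono divide_left_mono) (auto simp: Hardy_norm_nonneg)
      finally show ?thesis .
    qed
    have circ: "cmod (f u) \<le> C * Hardy_norm p F" if u: "cmod u = \<rho>" for u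
    proof -
      have "cmod v < 1" if "v \<in> cball u d" for v
        using norm_triangle_sub[of v u] that u d by (simp add: dist_norm norm_minus_commute)
      then have sub: "cball u d \<subseteq> unit_disc" "ball u d \<subseteq> unit_disc"
        by auto
      have "cmod ((deriv ^^ 1) F u) \<le> fact 1 * (4 / d * Hardy_norm p F) / d ^ 1"
      proof (rule Cauchy_inequality)
        show "F holomorphic_on ball u d" "continuous_on (cball u d) F"
          using sub holF by (auto intro: holomorphic_on_subset continuous_on_subset holomorphic_on_imp_continuous_on)
        fix x assume "cmod (u - x) = d"
        then show "cmod (F x) \<le> 4 / d * Hardy_norm p F"
          using norm_triangle_ineq4[of u "u - x"] u by (intro Fle) simp
      qed (rule d)
      moreover have "deriv F u = f u * deriv g u"
        unfolding F_def using u \<rho> by (intro DERIV_imp_deriv Volterra_has_field_derivative g fH) auto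
      ultimately have "cmod (f u) * cmod (deriv g u) \<le> 4 / d / d * Hardy_norm p F"
        by (simp add: norm_mult)
      moreover have "cmod (f u) * \<delta> \<le> cmod (f u) * cmod (deriv g u)"
        by (intro mult_left_mono \<delta> u) auto
      ultimately have "cmod (f u) * \<delta> \<le> 4 / d / d * Hardy_norm p F" by linarith
      then have "cmod (f u) \<le> 4 / d / d * Hardy_norm p F / \<delta>"
        using \<delta>(1) by (subst pos_le_divide_eq)
      then show ?thesis by (simp add: C_def mult_ac)
    qed
    \<comment> \<open>Since \<open>r < \<rho>\<close>, the point \<open>z\<close> is enclosed by the
      circle and the bound passes inward by the maximum principle.\<close>
    show "cmod (f z) \<le> C * optimal_norm g p f"
      unfolding N
    proof (rule maximum_modulus_frontier[of f "cball 0 \<rho>"])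
      show "f holomorphic_on interior (cball 0 \<rho>)"
        using \<rho> by (intro holomorphic_on_subset[OF holf]) auto
      show "continuous_on (closure (cball 0 \<rho>)) f"
        using \<rho> by (intro continuous_on_subset[OF holomorphic_on_imp_continuous_on[OF holf]]) auto
    qed (use z \<rho> circ in auto)
  qed
qed

section \<open>The norm axioms on the optimal domain\<close>

lemma optimal_norm_add:
  assumes "1 \<le> p" "g holomorphic_on unit_disc" "f \<in> optimal_domain g p" "h \<in> optimal_domain g p"
  shows "f + h \<in> optimal_domain g p"
    "optimal_norm g p (f + h) \<le> optimal_norm g p f + optimal_norm g p h"
  using assms Hardy_norm_triangle[of p "Volterra g f" "Volterra g h"]
  by (auto simp: optimal_domain_def optimal_norm_def Volterra_add Hol_disc_add)

lemma optimal_norm_cmult: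
  assumes "1 \<le> p" "g holomorphic_on unit_disc" "f \<in> optimal_domain g p"
  shows "(\<lambda>z. c * f z) \<in> optimal_domain g p"
    "optimal_norm g p (\<lambda>z. c * f z) = cmod c * optimal_norm g p f"
  using assms Hardy_norm_cmult[of p "Volterra g f" c] Hardy_norm_cmult_le(1)[of p "Volterra g f" c]
  by (auto simp: optimal_domain_def optimal_norm_def Volterra_cmult Hol_disc_cmult)

text \<open>Reduces closure under subtraction to sums and scalar multiples.\<close>

lemma diff_fun_eq: "f - h = f + (\<lambda>z. - 1 * h z)" for f h :: "complex \<Rightarrow> complex"
  by (simp add: fun_eq_iff)

lemma Hol_disc_diff: "f \<in> Hol_disc \<Longrightarrow> h \<in> Hol_disc \<Longrightarrow> f - h \<in> Hol_disc"
  unfolding diff_fun_eq by (intro Hol_disc_add Hol_disc_cmult)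

lemma optimal_domain_diff:
  assumes "1 \<le> p" "g holomorphic_on unit_disc" "f \<in> optimal_domain g p" "h \<in> optimal_domain g p"
  shows "f - h \<in> optimal_domain g p"
  unfolding diff_fun_eq by (intro optimal_norm_add(1) optimal_norm_cmult(1) assms)

lemma zero_in_optimal_domain: "0 \<in> optimal_domain g p"
proof -
  have "Volterra g 0 = 0"
    by (rule ext) (simp add: Volterra_def)
  moreover have "Hardy_enorm p 0 = 0"
    by (simp add: Hardy_enorm_def)
  ultimately show ?thesis
    by (simp add: optimal_domain_def Hardy_space_def Hol_disc_def zero_fun_def)
qed

lemma optimal_norm_eq_0_iff:
  assumes "1 \<le> p" "g holomorphic_on unit_disc" "\<not> g constant_on unit_disc" "f \<in> optimal_domain g p"
  shows "optimal_norm g p f = 0 \<longleftrightarrow> f = 0"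
proof
  assume N: "optimal_norm g p f = 0"
  show "f = 0"
  proof
    fix z
    show "f z = 0 z"
    \<comment> \<open>Inside the disc the point bound is taken with radius \<open>cmod z\<close>;
      outside, \<open>f\<close> vanishes by the convention in \<open>Hol_disc\<close>.\<close>
    proof (cases "cmod z < 1")
      case True
      then show ?thesis
        using optimal_point_bound[OF assms(1-3) True] N assms(4)
        by (metis mult_zero_right norm_le_zero_iff order_refl zero_fun_apply)
    next
      case False
      then show ?thesis using assms(4) by (auto simp: optimal_domain_def Hol_disc_def)
    qed
  qed
next
  assume "f = 0"
  then show "optimal_norm g p f = 0"
    using optimal_norm_cmult(2)[OF assms(1,2) zero_in_optimal_domain, of 0] by (simp add: zero_fun_def)
qed

section \<open>Completeness\<close>

lemma optimal_norm_complete: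
  assumes p: "1 \<le> p" and g: "g holomorphic_on unit_disc" and nc: "\<not> g constant_on unit_disc"
    and s: "\<And>n. s n \<in> optimal_domain g p"
    and Cauchy: "\<And>e. 0 < e \<Longrightarrow> \<exists>M. \<forall>m\<ge>M. \<forall>n\<ge>M. optimal_norm g p (s m - s n) < e"
  shows "\<exists>x\<in>optimal_domain g p. (\<lambda>n. optimal_norm g p (s n - x)) \<longlonglongrightarrow> 0"
proof -
  \<comment> \<open>The pointwise limit on the whole plane: outside the disc every
    \<open>s n\<close> is 0, so \<open>x\<close> respects the convention of
    \<open>Hol_disc\<close>.\<close>
  define x where "x = (\<lambda>z. lim (\<lambda>n. s n z))"
  have sH: "s n \<in> Hol_disc" for n using s by (simp add: optimal_domain_def)
  have unif: "uniform_limit (cball 0 r) s x sequentially" if r: "r < 1" for r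
  proof -
    obtain C where C: "0 < C"
      "\<And>f z. f \<in> optimal_domain g p \<Longrightarrow> cmod z \<le> r \<Longrightarrow> cmod (f z) \<le> C * optimal_norm g p f"
      using optimal_point_bound[OF p g nc r] by metis
    have "uniformly_Cauchy_on (cball 0 r) s"
    proof (rule uniformly_Cauchy_onI)
      fix e :: real assume "0 < e"
      then obtain M where M: "\<And>m n. m \<ge> M \<Longrightarrow> n \<ge> M \<Longrightarrow> optimal_norm g p (s m - s n) < e / C"
        using Cauchy[of "e / C"] C(1) by (metis divide_pos_pos)
      have "dist (s m z) (s n z) < e" if "z \<in> cball 0 r" "m \<ge> M" "n \<ge> M" for z m n
      proof -
        have "cmod ((s m - s n) z) \<le> C * optimal_norm g p (s m - s n)"
          using that by (intro C optimal_domain_diff p g s) auto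
        also have "\<dots> < e" using M[OF that(2,3)] C(1) by (simp add: field_simps)
        finally show ?thesis by (simp add: dist_norm)
      qed
      then show "\<exists>M. \<forall>z\<in>cball 0 r. \<forall>m\<ge>M. \<forall>n\<ge>M. dist (s m z) (s n z) < e" by blast
    qed
    then show ?thesis
      unfolding x_def by (simp add: uniformly_convergent_eq_Cauchy flip: uniformly_convergent_uniform_limit_iff)
  qed
  have "x holomorphic_on unit_disc"
  proof (rule holomorphic_uniform_sequence)
    show "s n holomorphic_on unit_disc" for n using sH by (auto simp: Hol_disc_def)
    fix z assume z: "z \<in> unit_disc"
    define d where "d = (1 - cmod z) / 2"
    have d: "0 < d" "cmod z + d < 1" using z by (auto simp: d_def field_simps)
    \<comment> \<open>Uniform convergence is known on discs centred at 0, so the disc about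
      \<open>z\<close> is placed inside one of these.\<close>
    have sub: "cball z d \<subseteq> cball 0 (cmod z + d)"
      by (simp add: cball_subset_cball_iff)
    moreover have "cball 0 (cmod z + d) \<subseteq> unit_disc" using d by auto
    ultimately show "\<exists>d>0. cball z d \<subseteq> unit_disc \<and> uniform_limit (cball z d) s x sequentially"
      using d uniform_limit_on_subset[OF unif[OF d(2)] sub] by blast
  qed auto
  moreover have "x z = 0" if "z \<notin> unit_disc" for z
    using that sH unfolding x_def by (simp add: Hol_disc_def)
  ultimately have xH: "x \<in> Hol_disc" by (simp add: Hol_disc_def)
  have dH: "Volterra g (s n - x) \<in> Hol_disc" for n
    by (intro Volterra_in_Hol_disc g Hol_disc_diff sH xH)
  \<comment> \<open>The estimate is made for the extended norm, because membership of
    \<open>s n - x\<close> is not yet known and \<open>Hardy_norm\<close> would send an infinite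
    value to 0.\<close>
  have close: "\<exists>M. \<forall>n\<ge>M. Hardy_enorm p (Volterra g (s n - x)) \<le> ennreal e" if "0 < e" for e
  proof -
    define a where "a = e / 2"
    have a: "0 < a" "e = a + a" using that by (auto simp: a_def)
    obtain M where M: "\<And>m n. m \<ge> M \<Longrightarrow> n \<ge> M \<Longrightarrow> optimal_norm g p (s m - s n) < a"
      using Cauchy[OF a(1)] by blast
    have "Hardy_enorm p (Volterra g (s n - x)) \<le> ennreal e" if n: "n \<ge> M" for n
    proof (subst Hardy_enorm_le_iff)
      show "Volterra g (s n - x) holomorphic_on unit_disc" using dH by (simp add: Hol_disc_def)
      show "\<forall>r\<in>{0..<1}.
        integral {0..2*pi} (\<lambda>t. cmod (Volterra g (s n - x) (of_real r * cis t)) powr p) \<le> 2 * pi * e powr p"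
      proof
        fix r :: real assume r: "r \<in> {0..<1}"
        then obtain K where K: "0 < K"
          "\<And>f B z. f \<in> Hol_disc \<Longrightarrow> (\<And>u. cmod u \<le> r \<Longrightarrow> cmod (f u) \<le> B) \<Longrightarrow> cmod z \<le> r \<Longrightarrow>
      cmod (Volterra g f z) \<le> K * B"
          using Volterra_bound[OF g, of r] by (metis atLeastLessThan_iff)
        \<comment> \<open>The auxiliary index \<open>m\<close> may depend on the radius
          \<open>r\<close>; it disappears from the final estimate, and the threshold
          \<open>M\<close> for \<open>n\<close> does not depend on \<open>r\<close>.\<close>
        have "eventually (\<lambda>m. \<forall>z\<in>cball 0 r. dist (s m z) (x z) < a / K) sequentially"
          using uniform_limitD[OF unif[of r], of "a / K"] r a K by auto
        then obtain m where m: "m \<ge> M" "\<And>z. cmod z \<le> r \<Longrightarrow> dist (s m z) (x z) < a / K"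
          unfolding eventually_sequentially by (metis mem_cball_0 nle_le)
        define U where "U = Volterra g (s n - s m)"
        define W where "W = Volterra g (s m - x)"
        have UH: "U \<in> Hol_disc" and WH: "W \<in> Hol_disc"
          unfolding U_def W_def by (intro Volterra_in_Hol_disc g Hol_disc_diff sH xH)+
        have UW: "Volterra g (s n - x) = U + W"
          unfolding U_def W_def by (subst Volterra_add[symmetric]) (auto intro: g Hol_disc_diff sH xH)
        have "U \<in> Hardy_space p" "Hardy_norm p U < a"
          using M[OF n m(1)] optimal_domain_diff[OF p g s s, of n m]
          by (auto simp: U_def optimal_norm_def optimal_domain_def)
        then have "Hardy_enorm p U \<le> ennreal a"
          by (simp add: Hardy_enorm_eq_norm ennreal_leI)
        then have IU: "integral {0..2*pi} (\<lambda>t. cmod (U (of_real r * cis t)) powr p) \<le> 2 * pi * a powr p"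
          using UH a p r by (simp add: Hardy_enorm_le_iff Hol_disc_def)
        have Wle: "cmod (W z) \<le> a" if "cmod z \<le> r" for z
        proof -
          have "cmod (W z) \<le> K * (a / K)"
            unfolding W_def using m(2) that
            by (intro K Hol_disc_diff sH xH) (auto simp: dist_norm intro: less_imp_le)
          then show ?thesis using K by simp
        qed
        \<comment> \<open>A uniform bound \<open>a\<close> on the circle bounds the integral by that
          of a constant, which has the form required by Minkowski's inequality.\<close>
        have "integral {0..2*pi} (\<lambda>t. cmod (W (of_real r * cis t)) powr p) \<le> integral {0..2*pi} (\<lambda>t. a powr p)"
          using r p WH
          by (intro integral_le integrable_on_circle powr_mono2 Wle) (auto simp: Hol_disc_def norm_mult)
        then have IW: "integral {0..2*pi} (\<lambda>t. cmod (W (of_real r * cis t)) powr p) \<le> 2 * pi * a powr p"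
          by simp
        show "integral {0..2*pi} (\<lambda>t. cmod (Volterra g (s n - x) (of_real r * cis t)) powr p) \<le> 2 * pi * e powr p"
          unfolding UW a(2) plus_fun_apply using UH WH
          by (intro Minkowski_integral_bound continuous_on_circle p a r IU IW) (auto simp: Hol_disc_def)
      qed
    qed (use p that a in auto)
    then show ?thesis by blast
  qed
  have diff: "s n - x \<in> optimal_domain g p" "optimal_norm g p (s n - x) \<le> e"
    if "Hardy_enorm p (Volterra g (s n - x)) \<le> ennreal e" "0 < e" for n e
    using Hardy_spaceI[OF dH that(1)] that(2) Hol_disc_diff[OF sH xH]
    by (auto simp: optimal_domain_def optimal_norm_def)
  \<comment> \<open>One index suffices for membership of the limit, since \<open>x\<close> is the
    difference of the two members \<open>s n\<close> and \<open>s n - x\<close>.\<close>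
  obtain n where "s n - x \<in> optimal_domain g p"
    using close[of 1] diff(1)[of _ 1] by auto
  then have "s n - (s n - x) \<in> optimal_domain g p"
    by (rule optimal_domain_diff[OF p g s])
  moreover have "s n - (s n - x) = x"
    by (simp add: fun_eq_iff)
  ultimately have "x \<in> optimal_domain g p" by simp
  moreover have "(\<lambda>n. optimal_norm g p (s n - x)) \<longlonglongrightarrow> 0"
  proof (rule LIMSEQ_I)
    fix e :: real assume "0 < e"
    then obtain M where "\<forall>n\<ge>M. Hardy_enorm p (Volterra g (s n - x)) \<le> ennreal (e / 2)"
      using close[of "e / 2"] by auto
    then have "\<forall>n\<ge>M. norm (optimal_norm g p (s n - x) - 0) < e"
      using diff(2)[of _ "e / 2"] \<open>0 < e\<close> by (force simp: optimal_norm_def Hardy_norm_nonneg)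
    then show "\<exists>M. \<forall>n\<ge>M. norm (optimal_norm g p (s n - x) - 0) < e" by blast
  qed
  ultimately show ?thesis by blast
qed

theorem theorem2p1:
  fixes p :: real and g :: "complex \<Rightarrow> complex"
  assumes "1 \<le> p"
    and "g \<in> BMOA"
    and "\<not> g constant_on unit_disc"
  shows "complex_Banach_space_on (\<lambda>c f z. c * f z) (optimal_domain g p) (optimal_norm g p)"
proof -
  have g: "g holomorphic_on unit_disc"
    using assms(2) by (simp add: BMOA_def Hardy_space_def Hol_disc_def)
  interpret vector_space "\<lambda>(c::complex) (f :: complex \<Rightarrow> complex) z. c * f z"
    by unfold_locales (auto simp: fun_eq_iff algebra_simps)
  have "subspace (optimal_domain g p)"
    by (intro subspaceI zero_in_optimal_domain optimal_norm_add(1) optimal_norm_cmult(1) assms(1) g)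
  moreover have "vector_space (\<lambda>(c::complex) (f :: complex \<Rightarrow> complex) z. c * f z)"
    by (rule vector_space_axioms)
  ultimately show ?thesis
    unfolding complex_Banach_space_on_def
    using optimal_norm_add(2)[OF assms(1) g] optimal_norm_cmult(2)[OF assms(1) g]
      optimal_norm_eq_0_iff[OF assms(1) g assms(3)] optimal_norm_complete[OF assms(1) g assms(3)]
    by (auto simp: optimal_norm_def Hardy_norm_nonneg image_subset_iff)
qed

end
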